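(* Let $C=(c_{ij})$ be an $m\times n$ real matrix with nonnegative entries which is non-decomposable (i.e., $CC^T$ is irreducible when $m\le n$, and $C^TC$ is irreducible when $m>n$). Let $k$ be an integer with $1\le k\le \operatorname{rk}(C)$ and suppose $\operatorname{disc}_k(C)<1$. Then $$ s_k \le 9\,\operatorname{disc}_k(C)\,\bigl(k+2-9k\ln \operatorname{disc}_k(C)\bigr), $$ where $s_k$ is the $k$-th largest non-trivial singular value of the normalized table $C_{nor}$ (with the right-hand side read as $0$ when $\operatorname{disc}_k(C)=0$).
   Context: Row sums $d_{row,i}=\sum_{j=1}^n c_{ij}$ and column sums $d_{col,j}=\sum_{i=1}^m c_{ij}$ are positive under non-decomposability; $D_{row}=\operatorname{diag}(d_{row,1},\dots,d_{row,m})$, $D_{col}=\operatorname{diag}(d_{col,1},\dots,d_{col,n})$. The normalized table is $C_{nor}=D_{row}^{-1/2}CD_{col}^{-1/2}$. Its singular values lie in $[0,1]$; in non-increasing order they are $1=s_0>s_1\ge s_2\ge\dots$, where $s_0=1$ is the trivial singular value (simple under non-decomposability); thus $s_k$ is the $(k+1)$-th largest singular value of $C_{nor}$. For $X\subseteq\{1,\dots,m\}$, $Y\subseteq\{1,\dots,n\}$: $c(X,Y)=\sum_{i\in X}\sum_{j\in Y}c_{ij}$, $\operatorname{Vol}(X)=\sum_{i\in X}d_{row,i}$, $\operatorname{Vol}(Y)=\sum_{j\in Y}d_{col,j}$. For proper $k$-partitions (into nonempty parts) $R_1,\dots,R_k$ of the row indices and $C_1,\dots,C_k$ of the column indices, let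 $\rho(R_a,C_b)=\frac{c(R_a,C_b)}{\operatorname{Vol}(R_a)\operatorname{Vol}(C_b)}$ and $$\operatorname{disc}(C;R_1,\dots,R_k,C_1,\dots,C_k)=\max_{a,b\in\{1,\dots,k\}}\ \max_{\emptyset\ne X\subseteq R_a,\ \emptyset\ne Y\subseteq C_b}\frac{|c(X,Y)-\rho(R_a,C_b)\operatorname{Vol}(X)\operatorname{Vol}(Y)|}{\sqrt{\operatorname{Vol}(X)\operatorname{Vol}(Y)}}.$$ The minimum $k$-way discrepancy is $\operatorname{disc}_k(C)=\min \operatorname{disc}(C;R_1,\dots,R_k,C_1,\dots,C_k)$ over all such pairs of proper $k$-partitions. *)

theory Defs
  imports "HOL-Analysis.Analysis"
begin

definition row_sum :: "real^'n^'m \<Rightarrow> 'm \<Rightarrow> real" where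
  "row_sum C i = (\<Sum>j\<in>UNIV. C $ i $ j)"

definition col_sum :: "real^'n^'m \<Rightarrow> 'n \<Rightarrow> real" where
  "col_sum C j = (\<Sum>i\<in>UNIV. C $ i $ j)"

definition diag_matrix :: "('a \<Rightarrow> real) \<Rightarrow> real^'a^'a" where
  "diag_matrix d = (\<chi> i j. if i = j then d i else 0)"

definition normalized_table :: "real^'n^'m \<Rightarrow> real^'n^'m" where
  "normalized_table C =
     diag_matrix (\<lambda>i. row_sum C i powr (-1/2)) ** C ** diag_matrix (\<lambda>j. col_sum C j powr (-1/2))"

text \<open>A square matrix is reducible iff a simultaneous permutation of its rows and columns makes it
  block triangular, i.e. iff some nonempty proper index set \<open>S\<close> has no nonzero entry leading out
  of \<open>S\<close>.\<close>

definition irreducible_matrix :: "real^'a^'a \<Rightarrow> bool" where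
  "irreducible_matrix A \<longleftrightarrow>
     (\<forall>S. S \<noteq> {} \<and> S \<noteq> UNIV \<longrightarrow> (\<exists>i\<in>S. \<exists>j\<in>-S. A $ i $ j \<noteq> 0))"

definition non_decomposable :: "real^'n^'m \<Rightarrow> bool" where
  "non_decomposable C \<longleftrightarrow>
     (if CARD('m) \<le> CARD('n) then irreducible_matrix (C ** transpose C)
      else irreducible_matrix (transpose C ** C))"

definition eigenvalues :: "real^'a^'a \<Rightarrow> real set" where
  "eigenvalues A = {l. \<exists>x. x \<noteq> 0 \<and> A *v x = l *\<^sub>R x}"

definition eigenspace :: "real^'a^'a \<Rightarrow> real \<Rightarrow> (real^'a) set" where
  "eigenspace A l = {x. A *v x = l *\<^sub>R x}"

text \<open>Eigenvalues in non-increasing order, repeated by geometric multiplicity. It is applied to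
  symmetric matrices only, for which this is also the algebraic multiplicity and the set of
  eigenvalues is finite by the lemma below.\<close>

definition eigenvalue_list :: "real^'a^'a \<Rightarrow> real list" where
  "eigenvalue_list A =
     concat (map (\<lambda>l. replicate (dim (eigenspace A l)) l)
       (rev (sorted_list_of_set (eigenvalues A))))"

lemma finite_eigenvalues_symmetric:
  fixes A :: "real^'a^'a"
  assumes symm: "transpose A = A"
  shows "finite (eigenvalues A)"
proof -
  have "\<forall>l\<in>eigenvalues A. \<exists>x. x \<noteq> 0 \<and> A *v x = l *\<^sub>R x"
    by (simp add: eigenvalues_def)
  then obtain f where f0: "\<And>l. l \<in> eigenvalues A \<Longrightarrow> f l \<noteq> 0"
    and f: "\<And>l. l \<in> eigenvalues A \<Longrightarrow> A *v f l = l *\<^sub>R f l"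
    by (metis (no_types))
  have adj: "(A *v x) \<bullet> y = x \<bullet> (A *v y)" for x y :: "real^'a"
  proof -
    have "x v* A = A *v x"
      using transpose_matrix_vector[of A x] unfolding symm by (rule sym)
    then show ?thesis using dot_lmul_matrix[of x A y] by (simp only:)
  qed
  have orth: "f l \<bullet> f l' = 0"
    if "l \<in> eigenvalues A" "l' \<in> eigenvalues A" "l \<noteq> l'" for l l'
  proof -
    have "l * (f l \<bullet> f l') = l' * (f l \<bullet> f l')"
      using adj[of "f l" "f l'"]
      unfolding f[OF that(1)] f[OF that(2)] inner_scaleR_left inner_scaleR_right .
    then show ?thesis using that(3) by simp
  qed
  have inj: "inj_on f (eigenvalues A)"
  proof (rule inj_onI, rule ccontr)
    fix l l' assume *: "l \<in> eigenvalues A" "l' \<in> eigenvalues A" "f l = f l'" "l \<noteq> l'"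
    from orth[OF *(1,2,4)] have "f l = 0" unfolding *(3) by simp
    with f0[OF *(1)] show False by simp
  qed
  have "pairwise orthogonal (f ` eigenvalues A)"
    unfolding pairwise_def orthogonal_def using orth by blast
  moreover have "0 \<notin> f ` eigenvalues A" using f0 by fastforce
  ultimately have "independent (f ` eigenvalues A)"
    by (rule pairwise_orthogonal_independent)
  then have "finite (f ` eigenvalues A)" by (rule independent_imp_finite)
  then show ?thesis using inj by (rule finite_imageD)
qed

text \<open>The \<open>min m n\<close> singular values of an \<open>m \<times> n\<close> matrix, in non-increasing order.\<close>

definition singular_values :: "real^'n^'m \<Rightarrow> real list" where
  "singular_values A = map sqrt
     (if CARD('m) \<le> CARD('n) then eigenvalue_list (A ** transpose A)
      else eigenvalue_list (transpose A ** A))"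

text \<open>Indices start at 0, so that \<open>singular_value A k\<close> is the \<open>(k+1)\<close>-th largest singular value;
  it is 0 past the end of the list, which matters when \<open>k = min m n\<close>.\<close>

definition singular_value :: "real^'n^'m \<Rightarrow> nat \<Rightarrow> real" where
  "singular_value A k = (if k < length (singular_values A) then singular_values A ! k else 0)"

definition cut :: "real^'n^'m \<Rightarrow> 'm set \<Rightarrow> 'n set \<Rightarrow> real" where
  "cut C X Y = (\<Sum>i\<in>X. \<Sum>j\<in>Y. C $ i $ j)"

definition row_vol :: "real^'n^'m \<Rightarrow> 'm set \<Rightarrow> real" where
  "row_vol C X = (\<Sum>i\<in>X. row_sum C i)"

definition col_vol :: "real^'n^'m \<Rightarrow> 'n set \<Rightarrow> real" where
  "col_vol C Y = (\<Sum>j\<in>Y. col_sum C j)"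

text \<open>For positive row and column sums all denominators below are positive. A zero row or column sum
  falls under \<open>0 powr a = 0\<close> and \<open>x / 0 = 0\<close> and contributes nothing.\<close>

definition density :: "real^'n^'m \<Rightarrow> 'm set \<Rightarrow> 'n set \<Rightarrow> real" where
  "density C R S = cut C R S / (row_vol C R * col_vol C S)"

definition disc :: "real^'n^'m \<Rightarrow> 'm set set \<Rightarrow> 'n set set \<Rightarrow> real" where
  "disc C P Q = Max {\<bar>cut C X Y - density C R S * row_vol C X * col_vol C Y\<bar>
                       / sqrt (row_vol C X * col_vol C Y) | R S X Y.
                     R \<in> P \<and> S \<in> Q \<and> X \<noteq> {} \<and> X \<subseteq> R \<and> Y \<noteq> {} \<and> Y \<subseteq> S}"

definition proper_partition :: "nat \<Rightarrow> 'a set set \<Rightarrow> bool" where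
  "proper_partition k P \<longleftrightarrow> partition_on UNIV P \<and> card P = k"

text \<open>Labelling the parts is irrelevant for the discrepancy, so partitions are unlabelled. The set
  is nonempty whenever \<open>1 \<le> k \<le> min m n\<close>.\<close>

definition min_disc :: "nat \<Rightarrow> real^'n^'m \<Rightarrow> real" where
  "min_disc k C = Min {disc C P Q | P Q. proper_partition k P \<and> proper_partition k Q}"

end

theory Submission
  imports Defs
begin

text \<open>Fix partitions attaining the minimum, let \<open>\<alpha>\<close> be their discrepancy and \<open>E\<close> the difference between
  \<open>C\<close> and its block approximation, with entries \<open>c\<^sub>i\<^sub>j - \<rho>(R\<^sub>a, C\<^sub>b) d\<^sub>i d\<^sub>j\<close>. The normalized approximation
  has rank at most \<open>k\<close>, so by a dimension count \<open>s\<^sub>k\<close> is at most the norm of the normalized \<open>E\<close>.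

  By Cauchy-Schwarz over the blocks, \<open>\<bar>E(X, Y)\<bar> \<le> k \<alpha> sqrt (Vol X Vol Y)\<close> for all \<open>X\<close> and \<open>Y\<close>; moreover the
  row and column sums of \<open>\<bar>E\<bar>\<close> are at most twice those of \<open>C\<close>. Cutting the test vectors into dyadic
  annuli, the first bound handles annuli at distance at most \<open>L\<close> and the second all others, which
  gives \<open>s\<^sub>k \<le> 16 k \<alpha> (2L + 1) + 4 / 2 ^ L\<close> for every \<open>L\<close>. Take \<open>2 ^ L\<close> of order \<open>1 / \<alpha>\<close>; for large
  \<open>\<alpha>\<close> the trivial bound \<open>s\<^sub>k \<le> 2\<close> is enough.\<close>

subsection \<open>Eigenvalue lists and orthogonality constraints\<close>

text \<open>This locates the run of equal eigenvalues that contains position \<open>k\<close>. The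
  length bound later says that the eigenspaces up to and including this run have total dimension
  greater than \<open>k\<close>.\<close>

lemma concat_map_nth_split:
  assumes "k < length (concat (map F xs))"
  shows "\<exists>pre x post. xs = pre @ x # post \<and> k < length (concat (map F (pre @ [x])))
           \<and> concat (map F xs) ! k \<in> set (F x)"
  using assms
proof (induction xs arbitrary: k)
  case Nil
  then show ?case by simp
next
  case (Cons a xs)
  show ?case
  proof (cases "k < length (F a)")
    case True
    then show ?thesis
      by (intro exI[of _ "[]"] exI[of _ a] exI[of _ xs]) (simp add: nth_append)
  next
    case False
    with Cons.prems have "k - length (F a) < length (concat (map F xs))"
      by simp
    from Cons.IH[OF this] obtain pre x post where *: "xs = pre @ x # post"
      "k - length (F a) < length (concat (map F (pre @ [x])))"
      "concat (map F xs) ! (k - length (F a)) \<in> set (F x)"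
      by blast
    show ?thesis
      using * False
      by (intro exI[of _ "a # pre"] exI[of _ x] exI[of _ post]) (auto simp: nth_append)
  qed
qed

lemma subspace_eigenspace: "subspace (eigenspace A l)"
  by (auto simp: subspace_def eigenspace_def algebra_simps matrix_vector_right_distrib
      matrix_vector_mult_scaleR)

lemma inner_matrix_vector_transpose:
  fixes A :: "real^'n^'m"
  shows "x \<bullet> (A *v y) = (transpose A *v x) \<bullet> y"
  by (simp add: dot_lmul_matrix transpose_matrix_vector)

lemma inner_symmetric_matrix:
  fixes A :: "real^'a^'a"
  assumes "transpose A = A"
  shows "(A *v x) \<bullet> y = x \<bullet> (A *v y)"
  using inner_matrix_vector_transpose[of x A y] assms by simp

lemma orthogonal_eigenspaces:
  fixes A :: "real^'a^'a"
  assumes "transpose A = A" "x \<in> eigenspace A l" "y \<in> eigenspace A l'" "l \<noteq> l'"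
  shows "x \<bullet> y = 0"
proof -
  have "l * (x \<bullet> y) = l' * (x \<bullet> y)"
    using inner_symmetric_matrix[OF assms(1), of x y] assms(2,3) by (simp add: eigenspace_def)
  with assms(4) show ?thesis by simp
qed

lemma span_orthogonal_eigenspace:
  fixes A :: "real^'a^'a"
  assumes "transpose A = A" "l \<notin> S" "x \<in> eigenspace A l" "y \<in> span (\<Union>l\<in>S. eigenspace A l)"
  shows "x \<bullet> y = 0"
proof -
  have "orthogonal x y"
    using assms(4)
  proof (rule orthogonal_to_span)
    fix z assume "z \<in> (\<Union>l\<in>S. eigenspace A l)"
    with assms show "orthogonal x z"
      unfolding orthogonal_def by (blast intro: orthogonal_eigenspaces[of A])
  qed
  then show ?thesis by (simp add: orthogonal_def)
qed

text \<open>A new eigenspace is orthogonal to the span of the earlier ones, so dimensions add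
  up.\<close>

lemma dim_Union_eigenspaces:
  fixes A :: "real^'a^'a"
  assumes "transpose A = A" "finite S"
  shows "dim (\<Union>l\<in>S. eigenspace A l) = (\<Sum>l\<in>S. dim (eigenspace A l))"
  using assms(2)
proof induction
  case (insert l S)
  have "dim (eigenspace A l \<union> (\<Union>l\<in>S. eigenspace A l))
      = dim (eigenspace A l) + dim (\<Union>l\<in>S. eigenspace A l)"
    using span_orthogonal_eigenspace[OF assms(1) insert(2)]
    by (intro dim_orthogonal_sum) (blast intro: span_base)
  with insert show ?case by simp
qed simp

text \<open>Invariance of the span is carried through the induction because it is what makes the
  cross term between \<open>x\<close> and \<open>A *v y\<close> vanish; the quadratic form then
  splits over the eigenspaces.\<close>

lemma span_eigenspaces_Rayleigh:
  fixes A :: "real^'a^'a"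
  assumes "transpose A = A" "finite S" "\<forall>l\<in>S. c \<le> l" "w \<in> span (\<Union>l\<in>S. eigenspace A l)"
  shows "A *v w \<in> span (\<Union>l\<in>S. eigenspace A l) \<and> c * (w \<bullet> w) \<le> w \<bullet> (A *v w)"
  using assms(2-)
proof (induction arbitrary: w)
  case (insert l S)
  have "w \<in> span (eigenspace A l \<union> (\<Union>l\<in>S. eigenspace A l))"
    using insert.prems by simp
  then obtain x y where w: "w = x + y" and x: "x \<in> eigenspace A l"
    and y: "y \<in> span (\<Union>l\<in>S. eigenspace A l)"
    unfolding span_Un by (auto simp: span_eq_iff[THEN iffD2, OF subspace_eigenspace])
  have Ax: "A *v x = l *\<^sub>R x" using x by (simp add: eigenspace_def)
  have IH: "A *v y \<in> span (\<Union>l\<in>S. eigenspace A l)" "c * (y \<bullet> y) \<le> y \<bullet> (A *v y)"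
    using insert.IH[OF _ y] insert.prems by auto
  note orth = span_orthogonal_eigenspace[OF assms(1) insert(2) x]
  have "A *v w = l *\<^sub>R x + A *v y" using Ax w by (simp add: matrix_vector_right_distrib)
  moreover have "l *\<^sub>R x \<in> span (\<Union>l\<in>insert l S. eigenspace A l)"
    using x by (intro span_mul span_base) simp
  moreover have "A *v y \<in> span (\<Union>l\<in>insert l S. eigenspace A l)"
    using IH(1) by (rule span_mono[THEN subsetD, rotated]) auto
  moreover have "w \<bullet> (l *\<^sub>R x + A *v y) = l * (x \<bullet> x) + y \<bullet> (A *v y)"
    using orth[OF y] orth[OF IH(1)] by (simp add: w inner_add inner_commute)
  moreover have "w \<bullet> w = x \<bullet> x + y \<bullet> y"
    using orth[OF y] by (simp add: w inner_add inner_commute)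
  moreover have "c * (x \<bullet> x) \<le> l * (x \<bullet> x)"
    using insert.prems by (intro mult_right_mono) auto
  ultimately show ?case using IH(2) by (auto simp: algebra_simps intro: span_add)
qed simp

text \<open>The orthogonal complement of \<open>V\<close> has codimension \<open>dim V\<close>, too
  small to meet \<open>span W\<close> only in 0.\<close>

lemma dim_less_orthogonal_vector:
  fixes V W :: "'a::euclidean_space set"
  assumes "dim V < dim W"
  obtains w where "w \<noteq> 0" "w \<in> span W" "\<And>v. v \<in> V \<Longrightarrow> v \<bullet> w = 0"
proof -
  define Z where "Z = {y \<in> UNIV. \<forall>x\<in>span V. orthogonal x y}"
  have "subspace Z"
    by (auto simp: Z_def subspace_def orthogonal_def inner_right_distrib)
  have "dim Z + dim (span V) = dim (UNIV :: 'a set)"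
    unfolding Z_def by (rule dim_subspace_orthogonal_to_vectors) auto
  moreover have "dim {x + y |x y. x \<in> span W \<and> y \<in> Z} + dim (span W \<inter> Z) = dim (span W) + dim Z"
    by (rule dim_sums_Int) (use \<open>subspace Z\<close> in auto)
  moreover have "dim {x + y |x y. x \<in> span W \<and> y \<in> Z} \<le> dim (UNIV :: 'a set)"
    by (rule dim_subset) simp
  ultimately have "dim (span W \<inter> Z) \<noteq> 0"
    using assms by (simp del: dim_eq_0)
  then obtain w where "w \<in> span W \<inter> Z" "w \<noteq> 0"
    unfolding dim_eq_0 by blast
  then show ?thesis
    using that[of w] by (auto simp: Z_def orthogonal_def span_base)
qed

text \<open>One half of the Courant-Fischer principle: the eigenspaces of all eigenvalues from the
  top down to entry \<open>k\<close> span more than \<open>k\<close> dimensions, so they contain a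
  nonzero vector satisfying \<open>k\<close> linear constraints.\<close>

lemma eigenvalue_list_nth_orthogonal:
  fixes A :: "real^'n^'m" and V :: "(real^'m) set"
  assumes V: "finite V" "card V \<le> k"
    and k: "k < length (eigenvalue_list (A ** transpose A))"
  obtains w where "w \<noteq> 0" "\<And>v. v \<in> V \<Longrightarrow> v \<bullet> w = 0"
    "eigenvalue_list (A ** transpose A) ! k * (w \<bullet> w)
       \<le> (transpose A *v w) \<bullet> (transpose A *v w)"
proof -
  define M where "M = A ** transpose A"
  have symm: "transpose M = M" by (simp add: M_def matrix_transpose_mul)
  define ls where "ls = rev (sorted_list_of_set (eigenvalues M))"
  define F where "F = (\<lambda>l. replicate (dim (eigenspace M l)) l)"
  have el: "eigenvalue_list M = concat (map F ls)"
    by (simp add: eigenvalue_list_def ls_def F_def)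
  obtain pre x post where ls: "ls = pre @ x # post"
    and kx: "k < length (concat (map F (pre @ [x])))"
    and nth: "eigenvalue_list M ! k = x"
  proof -
    have "k < length (concat (map F ls))" using k by (simp add: M_def[symmetric] el)
    from concat_map_nth_split[OF this] obtain pre x post where "ls = pre @ x # post"
      "k < length (concat (map F (pre @ [x])))" "concat (map F ls) ! k \<in> set (F x)"
      by blast
    moreover from this(3) have "concat (map F ls) ! k = x" by (simp add: F_def)
    ultimately show ?thesis using that el by simp
  qed
  define S where "S = set (pre @ [x])"
  have dist: "distinct (pre @ [x])"
  proof -
    have "distinct ls" by (simp add: ls_def)
    then show ?thesis by (simp add: ls)
  qed
  \<comment> \<open>The list is decreasing, so \<open>x\<close> is the least eigenvalue collected in
    \<open>S\<close>.\<close>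
  have ge: "\<forall>l\<in>S. x \<le> l"
  proof -
    have "sorted (rev ls)" by (simp add: ls_def)
    then show ?thesis by (auto simp: ls S_def sorted_append)
  qed
  define W where "W = (\<Union>l\<in>S. eigenspace M l)"
  have "length (concat (map F (pre @ [x]))) = (\<Sum>l\<in>S. dim (eigenspace M l))"
    using sum_list_distinct_conv_sum_set[OF dist, of "\<lambda>l. dim (eigenspace M l)"]
    by (simp add: length_concat S_def F_def comp_def)
  then have dimW: "k < dim W"
    using kx dim_Union_eigenspaces[OF symm, of S] by (simp add: W_def S_def)
  have "dim V < dim W"
    using dim_le_card'[OF V(1)] V(2) dimW by simp
  then obtain w where w: "w \<noteq> 0" "w \<in> span W" "\<And>v. v \<in> V \<Longrightarrow> v \<bullet> w = 0"
    using dim_less_orthogonal_vector by blast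
  have "x * (w \<bullet> w) \<le> w \<bullet> (M *v w)"
    using span_eigenspaces_Rayleigh[OF symm _ ge] w(2) by (simp add: W_def S_def)
  also have "w \<bullet> (M *v w) = (transpose A *v w) \<bullet> (transpose A *v w)"
    unfolding M_def matrix_vector_mul_assoc[symmetric] by (rule inner_matrix_vector_transpose)
  finally show ?thesis using that w nth by (simp add: M_def)
qed

lemma sqrt_eigenvalue_list_nth_le:
  fixes A :: "real^'n^'m" and V :: "(real^'m) set"
  assumes V: "finite V" "card V \<le> k"
    and k: "k < length (eigenvalue_list (A ** transpose A))"
    and \<beta>: "\<And>u v. norm u \<le> 1 \<Longrightarrow> norm v \<le> 1 \<Longrightarrow> (\<And>q. q \<in> V \<Longrightarrow> q \<bullet> u = 0) \<Longrightarrow> u \<bullet> (A *v v) \<le> \<beta>"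
  shows "sqrt (eigenvalue_list (A ** transpose A) ! k) \<le> \<beta>"
proof -
  obtain w where w: "w \<noteq> 0" "\<And>v. v \<in> V \<Longrightarrow> v \<bullet> w = 0"
    "eigenvalue_list (A ** transpose A) ! k * (w \<bullet> w)
       \<le> (transpose A *v w) \<bullet> (transpose A *v w)"
    using eigenvalue_list_nth_orthogonal[OF V k] by blast
  define z where "z = transpose A *v w"
  have "eigenvalue_list (A ** transpose A) ! k \<le> (norm z / norm w)\<^sup>2"
    using w(1,3) by (simp add: z_def power_divide field_simps power2_norm_eq_inner)
  then have "sqrt (eigenvalue_list (A ** transpose A) ! k) \<le> norm z / norm w"
    by (simp add: real_le_rsqrt real_sqrt_le_iff' real_le_lsqrt)
  also have "\<dots> \<le> \<beta>"
  proof -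
    \<comment> \<open>The optimal partner of \<open>w\<close> is \<open>z\<close> scaled to norm 1;
      \<open>sgn z\<close> also covers \<open>z = 0\<close>, where it is 0.\<close>
    have "(w /\<^sub>R norm w) \<bullet> (A *v sgn z) \<le> \<beta>"
      using w(1,2) by (intro \<beta>) (auto simp: norm_sgn)
    moreover have "w \<bullet> (A *v sgn z) = z \<bullet> sgn z"
      unfolding z_def by (rule inner_matrix_vector_transpose)
    moreover have "z \<bullet> sgn z = norm z"
      by (cases "z = 0") (simp_all add: sgn_div_norm dot_square_norm power2_eq_square)
    ultimately show ?thesis by (simp add: divide_inverse_commute)
  qed
  finally show ?thesis .
qed

subsection \<open>Dyadic decomposition of a bilinear form\<close>

text \<open>Splitting \<open>X\<close> by the sign of \<open>h\<close> writes the sum of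
  \<open>\<bar>h i\<bar>\<close> as a difference of two subset sums, each at most \<open>M\<close>
  in absolute value.\<close>

lemma abs_weighted_sum_le:
  fixes h :: "'a \<Rightarrow> real"
  assumes "finite X" and M: "\<And>Z. Z \<subseteq> X \<Longrightarrow> \<bar>sum h Z\<bar> \<le> M"
    and f: "\<And>i. i \<in> X \<Longrightarrow> \<bar>f i\<bar> \<le> c" and "0 \<le> c"
  shows "\<bar>\<Sum>i\<in>X. f i * h i\<bar> \<le> 2 * c * M"
proof -
  have "\<bar>\<Sum>i\<in>X. f i * h i\<bar> \<le> (\<Sum>i\<in>X. \<bar>f i * h i\<bar>)" by (rule sum_abs)
  also have "\<dots> \<le> (\<Sum>i\<in>X. c * \<bar>h i\<bar>)"
    using f by (intro sum_mono) (simp add: abs_mult mult_right_mono)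
  also have "\<dots> = c * (\<Sum>i\<in>X. \<bar>h i\<bar>)" by (simp add: sum_distrib_left)
  also have "(\<Sum>i\<in>X. \<bar>h i\<bar>) = (\<Sum>i\<in>{i\<in>X. 0 \<le> h i}. h i) - (\<Sum>i\<in>{i\<in>X. h i < 0}. h i)"
  proof -
    have "(\<Sum>i\<in>X. \<bar>h i\<bar>) = (\<Sum>i\<in>{i\<in>X. 0 \<le> h i} \<union> {i\<in>X. h i < 0}. \<bar>h i\<bar>)"
      by (rule sum.cong) auto
    also have "\<dots> = (\<Sum>i\<in>{i\<in>X. 0 \<le> h i}. \<bar>h i\<bar>) + (\<Sum>i\<in>{i\<in>X. h i < 0}. \<bar>h i\<bar>)"
      using \<open>finite X\<close> by (intro sum.union_disjoint) auto
    finally show ?thesis by (simp add: sum_negf[symmetric] cong: sum.cong_simp)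
  qed
  also have "c * \<dots> \<le> c * (2 * M)"
    using M[of "{i\<in>X. 0 \<le> h i}"] M[of "{i\<in>X. h i < 0}"] \<open>0 \<le> c\<close>
    by (intro mult_left_mono) auto
  finally show ?thesis by simp
qed

text \<open>The level of 0 says nothing about its size, so the annuli below are cut from supports
  only.\<close>

definition dyadic_level :: "real \<Rightarrow> int" where
  "dyadic_level x = \<lfloor>log 2 \<bar>x\<bar>\<rfloor>"

lemma dyadic_level_bounds:
  assumes "x \<noteq> 0"
  shows "2 powr dyadic_level x \<le> \<bar>x\<bar>" "\<bar>x\<bar> < 2 * 2 powr dyadic_level x"
proof -
  have "2 powr dyadic_level x \<le> 2 powr log 2 \<bar>x\<bar>"
    unfolding dyadic_level_def by (intro powr_mono) auto
  then show "2 powr dyadic_level x \<le> \<bar>x\<bar>" using assms by simp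
  have "2 powr log 2 \<bar>x\<bar> < 2 powr (1 + dyadic_level x)"
    unfolding dyadic_level_def by (intro powr_less_mono) linarith+
  then show "\<bar>x\<bar> < 2 * 2 powr dyadic_level x" using assms by (simp add: powr_add)
qed

lemma abs_mult_le_of_dyadic_gap:
  assumes "x \<noteq> 0" "y \<noteq> 0" "dyadic_level x - dyadic_level y > int L"
  shows "\<bar>x * y\<bar> \<le> x\<^sup>2 / 2 ^ L"
proof -
  have "\<bar>y\<bar> \<le> 2 powr (1 + dyadic_level y)"
    using dyadic_level_bounds(2)[OF assms(2)] by (simp add: powr_add)
  \<comment> \<open>A strict gap between integers leaves room for the factor 2 lost in rounding
    \<open>y\<close> up.\<close>
  also have "\<dots> \<le> 2 powr (dyadic_level x - real L)"
    using assms(3) by (intro powr_mono) linarith+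
  also have "\<dots> = 2 powr dyadic_level x / 2 ^ L" by (simp add: powr_diff powr_realpow)
  also have "\<dots> \<le> \<bar>x\<bar> / 2 ^ L"
    using dyadic_level_bounds(1)[OF assms(1)] by (simp add: divide_right_mono)
  finally have "\<bar>x\<bar> * \<bar>y\<bar> \<le> \<bar>x\<bar> * (\<bar>x\<bar> / 2 ^ L)" by (intro mult_left_mono) auto
  then show ?thesis by (simp add: abs_mult power2_eq_square)
qed

text \<open>Each square depends on one index only, so the other index is summed out first by the row
  or column bound; each half contributes at most 2.\<close>

lemma weighted_schur_test:
  fixes E :: "'m::finite \<Rightarrow> 'n::finite \<Rightarrow> real"
  assumes row: "\<And>i. (\<Sum>j\<in>UNIV. \<bar>E i j\<bar>) \<le> 2 * d i"
    and col: "\<And>j. (\<Sum>i\<in>UNIV. \<bar>E i j\<bar>) \<le> 2 * e j"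
    and f: "(\<Sum>i\<in>UNIV. d i * (f i)\<^sup>2) \<le> 1" and g: "(\<Sum>j\<in>UNIV. e j * (g j)\<^sup>2) \<le> 1"
  shows "(\<Sum>i\<in>UNIV. \<Sum>j\<in>UNIV. \<bar>E i j\<bar> * ((f i)\<^sup>2 + (g j)\<^sup>2)) \<le> 4"
proof -
  have "(\<Sum>i\<in>UNIV. \<Sum>j\<in>UNIV. \<bar>E i j\<bar> * ((f i)\<^sup>2 + (g j)\<^sup>2))
      = (\<Sum>i\<in>UNIV. (\<Sum>j\<in>UNIV. \<bar>E i j\<bar>) * (f i)\<^sup>2) + (\<Sum>i\<in>UNIV. \<Sum>j\<in>UNIV. \<bar>E i j\<bar> * (g j)\<^sup>2)"
    by (simp add: distrib_left sum.distrib sum_distrib_right)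
  also have "(\<Sum>i\<in>UNIV. \<Sum>j\<in>UNIV. \<bar>E i j\<bar> * (g j)\<^sup>2) = (\<Sum>j\<in>UNIV. (\<Sum>i\<in>UNIV. \<bar>E i j\<bar>) * (g j)\<^sup>2)"
    by (subst sum.swap) (simp add: sum_distrib_right)
  also have "(\<Sum>i\<in>UNIV. (\<Sum>j\<in>UNIV. \<bar>E i j\<bar>) * (f i)\<^sup>2) \<le> (\<Sum>i\<in>UNIV. (2 * d i) * (f i)\<^sup>2)"
    by (intro sum_mono mult_right_mono row) auto
  also have "\<dots> = 2 * (\<Sum>i\<in>UNIV. d i * (f i)\<^sup>2)" by (simp add: sum_distrib_left mult.assoc)
  also have "\<dots> \<le> 2" using f by simp
  also have "(\<Sum>j\<in>UNIV. (\<Sum>i\<in>UNIV. \<bar>E i j\<bar>) * (g j)\<^sup>2) \<le> (\<Sum>j\<in>UNIV. (2 * e j) * (g j)\<^sup>2)"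
    by (intro sum_mono mult_right_mono col) auto
  also have "\<dots> = 2 * (\<Sum>j\<in>UNIV. e j * (g j)\<^sup>2)" by (simp add: sum_distrib_left mult.assoc)
  also have "\<dots> \<le> 2" using g by simp
  finally show ?thesis by simp
qed

text \<open>Rounding every value of \<open>f\<close> down to a power of 2 does not increase the
  weighted energy, and the annuli partition the support.\<close>

lemma dyadic_level_energy:
  fixes d f :: "'m::finite \<Rightarrow> real"
  assumes d: "\<And>i. 0 \<le> d i" and f: "(\<Sum>i\<in>UNIV. d i * (f i)\<^sup>2) \<le> 1"
  defines "F \<equiv> {i. f i \<noteq> 0}"
  shows "(\<Sum>s\<in>(\<lambda>i. dyadic_level (f i)) ` F.
            (2 powr s)\<^sup>2 * sum d {i\<in>F. dyadic_level (f i) = s}) \<le> 1"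
proof -
  have "(\<Sum>s\<in>(\<lambda>i. dyadic_level (f i)) ` F. (2 powr s)\<^sup>2 * sum d {i\<in>F. dyadic_level (f i) = s})
      = (\<Sum>s\<in>(\<lambda>i. dyadic_level (f i)) ` F.
           \<Sum>i\<in>{i\<in>F. dyadic_level (f i) = s}. d i * (2 powr dyadic_level (f i))\<^sup>2)"
    by (intro sum.cong refl) (simp add: sum_distrib_left mult.commute)
  also have "\<dots> = (\<Sum>i\<in>F. d i * (2 powr dyadic_level (f i))\<^sup>2)"
    by (rule sum.image_gen[symmetric]) simp
  also have "\<dots> \<le> (\<Sum>i\<in>F. d i * (f i)\<^sup>2)"
  proof (rule sum_mono)
    fix i assume "i \<in> F"
    then have "(2 powr dyadic_level (f i))\<^sup>2 \<le> \<bar>f i\<bar>\<^sup>2"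
      using dyadic_level_bounds(1)[of "f i"] by (intro power_mono) (auto simp: F_def)
    then show "d i * (2 powr dyadic_level (f i))\<^sup>2 \<le> d i * (f i)\<^sup>2"
      using d by (simp add: mult_left_mono)
  qed
  also have "\<dots> \<le> (\<Sum>i\<in>UNIV. d i * (f i)\<^sup>2)"
    using d by (intro sum_mono2) auto
  finally show ?thesis using f by simp
qed

lemma card_near_integers:
  "card {t\<in>T. \<bar>s - t\<bar> \<le> int L} \<le> 2 * L + 1"
proof -
  have "card {t\<in>T. \<bar>s - t\<bar> \<le> int L} \<le> card {s - int L..s + int L}"
    by (intro card_mono) auto
  then show ?thesis by simp
qed

text \<open>Every level has at most \<open>2 * L + 1\<close> near partners on the other side, so no
  \<open>a s\<close> or \<open>b t\<close> is counted more often than that.\<close>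

lemma sum_near_le:
  fixes a b :: "int \<Rightarrow> real"
  assumes "finite S" "finite T" and a: "\<And>s. 0 \<le> a s" "sum a S \<le> 1"
    and b: "\<And>t. 0 \<le> b t" "sum b T \<le> 1"
  shows "(\<Sum>s\<in>S. \<Sum>t\<in>T. if \<bar>s - t\<bar> \<le> int L then a s + b t else 0) \<le> 2 * (2 * real L + 1)"
proof -
  have one: "(\<Sum>s\<in>S. \<Sum>t\<in>T. if \<bar>s - t\<bar> \<le> int L then a s else 0) \<le> 2 * real L + 1"
    if "finite S" "finite T" "\<And>s. 0 \<le> a s" "sum a S \<le> 1" for S T and a :: "int \<Rightarrow> real"
  proof -
    have "(\<Sum>s\<in>S. \<Sum>t\<in>T. if \<bar>s - t\<bar> \<le> int L then a s else 0)
        = (\<Sum>s\<in>S. real (card {t\<in>T. \<bar>s - t\<bar> \<le> int L}) * a s)"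
      using that by (intro sum.cong refl) (simp add: sum.inter_filter[symmetric])
    also have "\<dots> \<le> (\<Sum>s\<in>S. (2 * real L + 1) * a s)"
    proof (intro sum_mono mult_right_mono that(3))
      show "real (card {t\<in>T. \<bar>s - t\<bar> \<le> int L}) \<le> 2 * real L + 1" for s
        using card_near_integers[of T s L] by linarith
    qed
    also have "\<dots> = (2 * real L + 1) * sum a S" by (simp add: sum_distrib_left)
    also have "\<dots> \<le> (2 * real L + 1) * 1" using that by (intro mult_left_mono) auto
    finally show ?thesis by simp
  qed
  have "(\<Sum>s\<in>S. \<Sum>t\<in>T. if \<bar>s - t\<bar> \<le> int L then a s + b t else 0)
      = (\<Sum>s\<in>S. \<Sum>t\<in>T. if \<bar>s - t\<bar> \<le> int L then a s else 0)
        + (\<Sum>s\<in>S. \<Sum>t\<in>T. if \<bar>s - t\<bar> \<le> int L then b t else 0)"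
    by (simp add: sum.distrib[symmetric] if_distrib cong: sum.cong if_cong)
  also have "(\<Sum>s\<in>S. \<Sum>t\<in>T. if \<bar>s - t\<bar> \<le> int L then b t else 0)
      = (\<Sum>t\<in>T. \<Sum>s\<in>S. if \<bar>t - s\<bar> \<le> int L then b t else 0)"
    by (subst sum.swap) (simp add: abs_minus_commute)
  finally show ?thesis
    using one[of S T a] one[of T S b] assms by simp
qed

text \<open>Pairs of annuli whose levels differ by at most \<open>L\<close> are controlled by the cut bound and AM-GM;
  for all other pairs one factor is at most \<open>2 ^ -L\<close> times the other, so the row and column sums of
  \<open>\<bar>E\<bar>\<close> suffice.\<close>

lemma bilinear_dyadic_bound:
  fixes E :: "'m::finite \<Rightarrow> 'n::finite \<Rightarrow> real"
  assumes d: "\<And>i. 0 \<le> d i" and e: "\<And>j. 0 \<le> e j" and "0 \<le> A"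
    and cut: "\<And>X Y. \<bar>\<Sum>i\<in>X. \<Sum>j\<in>Y. E i j\<bar> \<le> A * sqrt (sum d X * sum e Y)"
    and row: "\<And>i. (\<Sum>j\<in>UNIV. \<bar>E i j\<bar>) \<le> 2 * d i"
    and col: "\<And>j. (\<Sum>i\<in>UNIV. \<bar>E i j\<bar>) \<le> 2 * e j"
    and f: "(\<Sum>i\<in>UNIV. d i * (f i)\<^sup>2) \<le> 1" and g: "(\<Sum>j\<in>UNIV. e j * (g j)\<^sup>2) \<le> 1"
  shows "\<bar>\<Sum>i\<in>UNIV. \<Sum>j\<in>UNIV. E i j * f i * g j\<bar> \<le> 16 * A * (2 * real L + 1) + 4 / 2 ^ L"
proof -
  define F where "F = {i. f i \<noteq> 0}"
  define G where "G = {j. g j \<noteq> 0}"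
  define S where "S = (\<lambda>i. dyadic_level (f i)) ` F"
  define T where "T = (\<lambda>j. dyadic_level (g j)) ` G"
  define X where "X s = {i\<in>F. dyadic_level (f i) = s}" for s
  define Y where "Y t = {j\<in>G. dyadic_level (g j) = t}" for t
  define a where "a s = (2 powr real_of_int s)\<^sup>2 * sum d (X s)" for s
  define b where "b t = (2 powr real_of_int t)\<^sup>2 * sum e (Y t)" for t
  define w where "w i j = \<bar>E i j\<bar> * ((f i)\<^sup>2 + (g j)\<^sup>2) / 2 ^ L" for i j
  have a0: "0 \<le> a s" and b0: "0 \<le> b s" for s
    using d e by (simp_all add: a_def b_def sum_nonneg)
  have split: "(\<Sum>i\<in>F. \<Sum>j\<in>G. h i j) = (\<Sum>s\<in>S. \<Sum>t\<in>T. \<Sum>i\<in>X s. \<Sum>j\<in>Y t. h i j)"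
    for h :: "'m \<Rightarrow> 'n \<Rightarrow> real"
  proof -
    have "(\<Sum>i\<in>F. \<Sum>j\<in>G. h i j) = (\<Sum>s\<in>S. \<Sum>i\<in>X s. \<Sum>j\<in>G. h i j)"
      unfolding S_def X_def by (rule sum.image_gen) simp
    also have "\<dots> = (\<Sum>s\<in>S. \<Sum>i\<in>X s. \<Sum>t\<in>T. \<Sum>j\<in>Y t. h i j)"
      unfolding T_def Y_def by (intro sum.cong refl sum.image_gen) simp
    also have "\<dots> = (\<Sum>s\<in>S. \<Sum>t\<in>T. \<Sum>i\<in>X s. \<Sum>j\<in>Y t. h i j)"
      by (intro sum.cong refl sum.swap)
    finally show ?thesis .
  qed
  \<comment> \<open>The far-pair term \<open>w\<close> is kept in both cases, so that it can be
    summed over all pairs of annuli and hence over all indices at once.\<close>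
  have block: "\<bar>\<Sum>i\<in>X s. \<Sum>j\<in>Y t. E i j * f i * g j\<bar>
      \<le> (if \<bar>s - t\<bar> \<le> int L then 8 * A * (a s + b t) else 0) + (\<Sum>i\<in>X s. \<Sum>j\<in>Y t. w i j)" for s t
  proof (cases "\<bar>s - t\<bar> \<le> int L")
    case True
    define p where "p = 2 powr real_of_int s"
    define q where "q = 2 powr real_of_int t"
    have fp: "\<bar>f i\<bar> \<le> 2 * p" if "i \<in> X s" for i
      using that dyadic_level_bounds(2)[of "f i"] by (auto simp: X_def F_def p_def)
    have gq: "\<bar>g j\<bar> \<le> 2 * q" if "j \<in> Y t" for j
      using that dyadic_level_bounds(2)[of "g j"] by (auto simp: Y_def G_def q_def)
    let ?M = "A * sqrt (sum d (X s) * sum e (Y t))"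
    \<comment> \<open>Two uses of \<open>abs_weighted_sum_le\<close>, for \<open>f\<close> outside
      and \<open>g\<close> inside, pass from cuts to weighted sums. Each costs a factor 2 and each
      annulus another 2, whence 16 in total.\<close>
    have "\<bar>\<Sum>i\<in>X s. f i * (\<Sum>j\<in>Y t. g j * E i j)\<bar> \<le> 2 * (2 * p) * (2 * (2 * q) * ?M)"
    proof (rule abs_weighted_sum_le)
      fix Z assume Z: "Z \<subseteq> X s"
      have "(\<Sum>i\<in>Z. \<Sum>j\<in>Y t. g j * E i j) = (\<Sum>j\<in>Y t. g j * (\<Sum>i\<in>Z. E i j))"
        by (subst sum.swap) (simp add: sum_distrib_left)
      also have "\<bar>\<dots>\<bar> \<le> 2 * (2 * q) * ?M"
      proof (rule abs_weighted_sum_le)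
        fix Z' assume Z': "Z' \<subseteq> Y t"
        have "\<bar>\<Sum>j\<in>Z'. \<Sum>i\<in>Z. E i j\<bar> \<le> A * sqrt (sum d Z * sum e Z')"
          using cut[where X = Z and Y = Z'] by (subst sum.swap)
        also have "\<dots> \<le> ?M"
          using Z Z' d e \<open>0 \<le> A\<close>
          by (intro mult_left_mono real_sqrt_le_mono mult_mono sum_mono2 sum_nonneg) auto
        finally show "\<bar>\<Sum>j\<in>Z'. \<Sum>i\<in>Z. E i j\<bar> \<le> ?M" .
      qed (use gq q_def in auto)
      finally show "\<bar>\<Sum>i\<in>Z. \<Sum>j\<in>Y t. g j * E i j\<bar> \<le> 2 * (2 * q) * ?M" .
    qed (use fp p_def in auto)
    moreover have "(\<Sum>i\<in>X s. f i * (\<Sum>j\<in>Y t. g j * E i j)) = (\<Sum>i\<in>X s. \<Sum>j\<in>Y t. E i j * f i * g j)"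
      by (simp add: sum_distrib_left mult_ac)
    moreover have "2 * (p * q * sqrt (sum d (X s) * sum e (Y t))) \<le> a s + b t"
    proof -
      have "2 * (p * sqrt (sum d (X s))) * (q * sqrt (sum e (Y t)))
          \<le> (p * sqrt (sum d (X s)))\<^sup>2 + (q * sqrt (sum e (Y t)))\<^sup>2"
        by (rule sum_squares_bound)
      also have "\<dots> = a s + b t"
        using d e by (simp add: a_def b_def p_def q_def power_mult_distrib sum_nonneg)
      finally show ?thesis by (simp add: real_sqrt_mult mult_ac)
    qed
    then have "8 * A * (2 * (p * q * sqrt (sum d (X s) * sum e (Y t)))) \<le> 8 * A * (a s + b t)"
      using \<open>0 \<le> A\<close> by (intro mult_left_mono) auto
    moreover have "0 \<le> (\<Sum>i\<in>X s. \<Sum>j\<in>Y t. w i j)" by (intro sum_nonneg) (simp add: w_def)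
    ultimately show ?thesis using True by (simp add: algebra_simps)
  next
    case False
    have "\<bar>\<Sum>i\<in>X s. \<Sum>j\<in>Y t. E i j * f i * g j\<bar> \<le> (\<Sum>i\<in>X s. \<Sum>j\<in>Y t. \<bar>E i j * f i * g j\<bar>)"
      by (intro order_trans[OF sum_abs] sum_mono) simp
    also have "\<dots> \<le> (\<Sum>i\<in>X s. \<Sum>j\<in>Y t. w i j)"
    proof (intro sum_mono)
      fix i j assume ij: "i \<in> X s" "j \<in> Y t"
      \<comment> \<open>The gap may favour either factor; the sum of both squares serves both
        cases.\<close>
      then have "\<bar>f i * g j\<bar> \<le> (f i)\<^sup>2 / 2 ^ L \<or> \<bar>g j * f i\<bar> \<le> (g j)\<^sup>2 / 2 ^ L"
        using abs_mult_le_of_dyadic_gap[of "f i" "g j" L] abs_mult_le_of_dyadic_gap[of "g j" "f i" L] False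
        unfolding X_def Y_def F_def G_def by (smt (verit) mem_Collect_eq)
      moreover have "0 \<le> (f i)\<^sup>2 / 2 ^ L" "0 \<le> (g j)\<^sup>2 / 2 ^ L" by auto
      ultimately have "\<bar>f i * g j\<bar> \<le> ((f i)\<^sup>2 + (g j)\<^sup>2) / 2 ^ L"
        unfolding add_divide_distrib by (simp only: mult.commute[of "g j"]) linarith
      then have "\<bar>E i j\<bar> * \<bar>f i * g j\<bar> \<le> \<bar>E i j\<bar> * (((f i)\<^sup>2 + (g j)\<^sup>2) / 2 ^ L)"
        by (intro mult_left_mono) auto
      then show "\<bar>E i j * f i * g j\<bar> \<le> w i j" by (simp add: w_def abs_mult mult.assoc)
    qed
    finally show ?thesis using False by simp
  qed
  have "(\<Sum>i\<in>UNIV. \<Sum>j\<in>UNIV. E i j * f i * g j) = (\<Sum>i\<in>F. \<Sum>j\<in>G. E i j * f i * g j)"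
  proof -
    have "(\<Sum>i\<in>F. \<Sum>j\<in>G. E i j * f i * g j) = (\<Sum>i\<in>F. \<Sum>j\<in>UNIV. E i j * f i * g j)"
      by (intro sum.cong refl sum.mono_neutral_left) (auto simp: G_def)
    also have "\<dots> = (\<Sum>i\<in>UNIV. \<Sum>j\<in>UNIV. E i j * f i * g j)"
      by (intro sum.mono_neutral_left) (auto simp: F_def)
    finally show ?thesis ..
  qed
  also have "\<bar>\<dots>\<bar> \<le> (\<Sum>s\<in>S. \<Sum>t\<in>T. \<bar>\<Sum>i\<in>X s. \<Sum>j\<in>Y t. E i j * f i * g j\<bar>)"
    unfolding split by (rule order_trans[OF sum_abs sum_mono[OF sum_abs]])
  also have "\<dots> \<le> (\<Sum>s\<in>S. \<Sum>t\<in>T. (if \<bar>s - t\<bar> \<le> int L then 8 * A * (a s + b t) else 0)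
                     + (\<Sum>i\<in>X s. \<Sum>j\<in>Y t. w i j))"
    by (intro sum_mono block)
  also have "\<dots> = (\<Sum>s\<in>S. \<Sum>t\<in>T. if \<bar>s - t\<bar> \<le> int L then 8 * A * (a s + b t) else 0)
                   + (\<Sum>i\<in>F. \<Sum>j\<in>G. w i j)"
    by (simp add: split sum.distrib)
  also have "(\<Sum>s\<in>S. \<Sum>t\<in>T. if \<bar>s - t\<bar> \<le> int L then 8 * A * (a s + b t) else 0)
      = 8 * A * (\<Sum>s\<in>S. \<Sum>t\<in>T. if \<bar>s - t\<bar> \<le> int L then a s + b t else 0)"
    unfolding sum_distrib_left by (intro sum.cong refl) simp
  also have "\<dots> \<le> 8 * A * (2 * (2 * real L + 1))"
  proof (intro mult_left_mono sum_near_le a0 b0)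
    show "sum a S \<le> 1"
      using dyadic_level_energy[OF d f] by (simp add: a_def S_def X_def F_def)
    show "sum b T \<le> 1"
      using dyadic_level_energy[OF e g] by (simp add: b_def T_def Y_def G_def)
  qed (use \<open>0 \<le> A\<close> in \<open>auto simp: S_def T_def\<close>)
  also have "(\<Sum>i\<in>F. \<Sum>j\<in>G. w i j) \<le> (\<Sum>i\<in>UNIV. \<Sum>j\<in>UNIV. w i j)"
  proof -
    have "(\<Sum>i\<in>F. \<Sum>j\<in>G. w i j) \<le> (\<Sum>i\<in>F. \<Sum>j\<in>UNIV. w i j)"
      by (intro sum_mono sum_mono2) (auto simp: w_def)
    also have "\<dots> \<le> (\<Sum>i\<in>UNIV. \<Sum>j\<in>UNIV. w i j)"
      by (intro sum_mono2 sum_nonneg) (auto simp: w_def)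
    finally show ?thesis .
  qed
  also have "\<dots> = (\<Sum>i\<in>UNIV. \<Sum>j\<in>UNIV. \<bar>E i j\<bar> * ((f i)\<^sup>2 + (g j)\<^sup>2)) / 2 ^ L"
    by (simp add: w_def sum_divide_distrib)
  also have "\<dots> \<le> 4 / 2 ^ L"
    using weighted_schur_test[OF row col f g] by (intro divide_right_mono) auto
  finally show ?thesis by (simp add: algebra_simps)
qed

subsection \<open>Block approximation of a contingency table\<close>

lemma sum_partition:
  fixes h :: "'a::finite \<Rightarrow> real"
  assumes "partition_on UNIV P"
  shows "sum h X = (\<Sum>R\<in>P. sum h (X \<inter> R))"
proof -
  have "X = (\<Union>R\<in>P. X \<inter> R)" using assms by (auto simp: partition_on_def)
  then have "sum h X = sum h (\<Union>R\<in>P. X \<inter> R)" by simp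
  also have "\<dots> = (\<Sum>R\<in>P. sum h (X \<inter> R))"
    using assms by (intro sum.UNION_disjoint) (auto simp: partition_on_def disjoint_def)
  finally show ?thesis .
qed

text \<open>Cauchy-Schwarz. The loss of \<open>sqrt k\<close> on the row side and again on the
  column side produces the factor \<open>k\<close> in the cut bound.\<close>

lemma sum_sqrt_partition_le:
  fixes d :: "'a::finite \<Rightarrow> real"
  assumes "partition_on UNIV P" "\<And>i. 0 \<le> d i"
  shows "(\<Sum>R\<in>P. sqrt (sum d (X \<inter> R))) \<le> sqrt (real (card P)) * sqrt (sum d X)"
proof -
  have "(\<Sum>R\<in>P. sqrt (sum d (X \<inter> R)))\<^sup>2 \<le> (\<Sum>R\<in>P. (sqrt (sum d (X \<inter> R)))\<^sup>2) * card P"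
    by (rule sum_squared_le_sum_of_squares)
  also have "\<dots> = sum d X * card P"
    unfolding sum_partition[OF assms(1), of d X] using assms(2) by (simp add: sum_nonneg)
  finally have "(\<Sum>R\<in>P. sqrt (sum d (X \<inter> R))) \<le> sqrt (sum d X * card P)"
    by (rule real_le_rsqrt)
  then show ?thesis by (simp add: real_sqrt_mult mult.commute)
qed

lemma partition_on_UNIV_card_exists:
  assumes "1 \<le> k" "k \<le> CARD('a::finite)"
  shows "\<exists>P :: 'a set set. proper_partition k P"
proof -
  \<comment> \<open>The partition consists of \<open>k - 1\<close> singletons and the complement of
    their union, which is nonempty because \<open>k - 1 < CARD('a)\<close>.\<close>
  obtain S :: "'a set" where S: "card S = k - 1"
    using obtain_subset_with_card_n[of "k - 1" "UNIV :: 'a set"] assms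
    by (metis diff_le_self le_trans)
  have "S \<noteq> UNIV" using S assms by auto
  then have "partition_on UNIV (insert (- S) ((\<lambda>x. {x}) ` S))"
    by (auto simp: partition_on_def disjoint_def)
  moreover have "card (insert (- S) ((\<lambda>x. {x}) ` S)) = k"
    using S assms by (subst card_insert_disjoint) (auto simp: card_image)
  ultimately show ?thesis by (auto simp: proper_partition_def)
qed

definition part :: "'a set set \<Rightarrow> 'a \<Rightarrow> 'a set" where
  "part P i = (THE R. R \<in> P \<and> i \<in> R)"

lemma part_eq:
  assumes "partition_on A P" "R \<in> P" "i \<in> R"
  shows "part P i = R"
  unfolding part_def using assms by (intro the_equality) (auto simp: partition_on_def disjoint_def)

lemma part_mem:
  assumes "partition_on UNIV P"
  shows "part P i \<in> P"
proof -
  have "i \<in> \<Union>P" using assms by (simp add: partition_on_def)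
  then obtain R where "R \<in> P" "i \<in> R" by blast
  with part_eq[OF assms this] show ?thesis by simp
qed

text \<open>Normalization turns the weights \<open>d\<close> on a part into their square roots, so
  the normalized block approximation is a combination of outer products of these vectors.\<close>

definition part_vector :: "('a::finite \<Rightarrow> real) \<Rightarrow> 'a set \<Rightarrow> real^'a" where
  "part_vector d R = (\<chi> i. if i \<in> R then sqrt (d i) else 0)"

lemma part_vector_inner: "part_vector d R \<bullet> u = (\<Sum>i\<in>R. sqrt (d i) * u $ i)"
  by (simp add: part_vector_def inner_vec_def if_distrib if_distribR sum.If_cases cong: if_cong)

text \<open>After normalization the subtracted term has rank at most \<open>k\<close> and is annihilated on either
  side by the vectors orthogonal to all \<open>part_vector\<close>s of that side.\<close>

definition deviation :: "real^'n^'m \<Rightarrow> 'm set set \<Rightarrow> 'n set set \<Rightarrow> 'm \<Rightarrow> 'n \<Rightarrow> real" where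
  "deviation C P Q i j =
     C $ i $ j - density C (part P i) (part Q j) * row_sum C i * col_sum C j"

lemma row_sum_transpose: "row_sum (transpose C) = col_sum C"
  by (simp add: row_sum_def col_sum_def transpose_def fun_eq_iff)

lemma col_sum_transpose: "col_sum (transpose C) = row_sum C"
  by (simp add: row_sum_def col_sum_def transpose_def fun_eq_iff)

lemma density_transpose: "density (transpose C) Y X = density C X Y"
proof -
  have "cut (transpose C) Y X = cut C X Y"
    unfolding cut_def by (subst sum.swap) (simp add: transpose_def)
  then show ?thesis
    by (simp add: density_def row_vol_def col_vol_def row_sum_transpose col_sum_transpose mult.commute)
qed

text \<open>This symmetry lets the column bound for the deviation follow from the row bound.\<close>

lemma deviation_transpose: "deviation (transpose C) Q P j i = deviation C P Q i j"
  by (simp add: deviation_def density_transpose row_sum_transpose col_sum_transpose)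
    (simp add: transpose_def)

lemma normalized_table_nth:
  "normalized_table C $ i $ j = row_sum C i powr (-1/2) * C $ i $ j * col_sum C j powr (-1/2)"
  by (simp add: normalized_table_def diag_matrix_def matrix_matrix_mult_def if_distrib if_distribR
      sum.delta cong: if_cong)

section \<open>Discrepancy bounds for the deviation of a nonnegative table\<close>

context
  fixes C :: "real^'n^'m"
  assumes nonneg: "\<forall>i j. 0 \<le> C $ i $ j"
begin

lemma row_sum_nonneg: "0 \<le> row_sum C i"
  using nonneg by (auto simp: row_sum_def intro: sum_nonneg)

lemma col_sum_nonneg: "0 \<le> col_sum C j"
  using nonneg by (auto simp: col_sum_def intro: sum_nonneg)

lemma row_vol_nonneg: "0 \<le> row_vol C X"
  using row_sum_nonneg by (auto simp: row_vol_def intro: sum_nonneg)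

lemma col_vol_nonneg: "0 \<le> col_vol C Y"
  using col_sum_nonneg by (auto simp: col_vol_def intro: sum_nonneg)

lemma cut_nonneg: "0 \<le> cut C X Y"
  using nonneg by (auto simp: cut_def intro!: sum_nonneg)

lemma density_nonneg: "0 \<le> density C X Y"
  by (simp add: density_def cut_nonneg row_vol_nonneg col_vol_nonneg)

lemma cut_le_row_vol: "cut C X Y \<le> row_vol C X"
  unfolding cut_def row_vol_def row_sum_def using nonneg by (intro sum_mono sum_mono2) auto

lemma cut_le_col_vol: "cut C X Y \<le> col_vol C Y"
  unfolding cut_def col_vol_def col_sum_def
  by (subst sum.swap) (use nonneg in \<open>auto intro!: sum_mono sum_mono2\<close>)

lemma disc_upper:
  assumes "R \<in> P" "S \<in> Q" "X \<noteq> {}" "X \<subseteq> R" "Y \<noteq> {}" "Y \<subseteq> S"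
  shows "\<bar>cut C X Y - density C R S * row_vol C X * col_vol C Y\<bar>
           / sqrt (row_vol C X * col_vol C Y) \<le> disc C P Q"
proof -
  let ?h = "\<lambda>(R, S, X, Y). \<bar>cut C X Y - density C R S * row_vol C X * col_vol C Y\<bar>
                       / sqrt (row_vol C X * col_vol C Y)"
  let ?D = "{?h (R, S, X, Y) | R S X Y. R \<in> P \<and> S \<in> Q \<and> X \<noteq> {} \<and> X \<subseteq> R \<and> Y \<noteq> {} \<and> Y \<subseteq> S}"
  have "?D \<subseteq> range ?h" by blast
  then have "finite ?D" by (rule finite_subset) simp
  moreover have "?h (R, S, X, Y) \<in> ?D" using assms by blast
  ultimately have "?h (R, S, X, Y) \<le> Max ?D" by (rule Max_ge)
  then show ?thesis by (simp add: disc_def)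
qed

text \<open>Clearing the denominator extends the estimate to empty sets and sets of zero volume:
  there the cut vanishes with the volume, and both sides are 0.\<close>

lemma cut_deviation_le_disc:
  assumes "R \<in> P" "S \<in> Q" "X \<subseteq> R" "Y \<subseteq> S"
  shows "\<bar>cut C X Y - density C R S * row_vol C X * col_vol C Y\<bar>
           \<le> disc C P Q * sqrt (row_vol C X * col_vol C Y)"
proof (cases "row_vol C X = 0 \<or> col_vol C Y = 0")
  case True
  then have "cut C X Y = 0"
    using cut_nonneg[of X Y] cut_le_row_vol[of X Y] cut_le_col_vol[of X Y] by linarith
  with True show ?thesis by auto
next
  case False
  then have "X \<noteq> {}" "Y \<noteq> {}" by (auto simp: row_vol_def col_vol_def)
  moreover have "0 < sqrt (row_vol C X * col_vol C Y)"
    using False row_vol_nonneg[of X] col_vol_nonneg[of Y] by (simp add: order.strict_iff_order)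
  ultimately show ?thesis
    using disc_upper[OF assms(1,2) _ assms(3) _ assms(4)] by (simp add: pos_divide_le_eq)
qed

lemma disc_nonneg:
  assumes "partition_on UNIV P" "partition_on UNIV Q"
  shows "0 \<le> disc C P Q"
proof -
  \<comment> \<open>The part of an arbitrary index gives one admissible block; a single nonnegative
    ratio suffices for the maximum.\<close>
  define R where "R = part P undefined"
  define S where "S = part Q undefined"
  have RS: "R \<in> P" "S \<in> Q" using assms by (simp_all add: R_def S_def part_mem)
  with assms have "R \<noteq> {}" "S \<noteq> {}" unfolding partition_on_def by blast+
  from disc_upper[OF RS this(1) order.refl this(2) order.refl]
  show ?thesis
    by (rule order_trans[rotated]) (simp add: row_vol_nonneg col_vol_nonneg)
qed

lemma deviation_cut_le:
  assumes P: "proper_partition k P" and Q: "proper_partition k Q"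
  shows "\<bar>\<Sum>i\<in>X. \<Sum>j\<in>Y. deviation C P Q i j\<bar>
           \<le> real k * disc C P Q * sqrt (sum (row_sum C) X * sum (col_sum C) Y)"
proof -
  have P': "partition_on UNIV P" "card P = k" and Q': "partition_on UNIV Q" "card Q = k"
    using P Q by (auto simp: proper_partition_def)
  let ?a = "\<lambda>R. sqrt (sum (row_sum C) (X \<inter> R))" and ?b = "\<lambda>S. sqrt (sum (col_sum C) (Y \<inter> S))"
  have block: "\<bar>\<Sum>i\<in>X \<inter> R. \<Sum>j\<in>Y \<inter> S. deviation C P Q i j\<bar> \<le> disc C P Q * (?a R * ?b S)"
    if "R \<in> P" "S \<in> Q" for R S
  proof -
    have "(\<Sum>i\<in>X \<inter> R. \<Sum>j\<in>Y \<inter> S. deviation C P Q i j)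
        = (\<Sum>i\<in>X \<inter> R. \<Sum>j\<in>Y \<inter> S. C $ i $ j - density C R S * row_sum C i * col_sum C j)"
      using part_eq[OF P'(1) that(1)] part_eq[OF Q'(1) that(2)]
      by (intro sum.cong refl) (simp add: deviation_def)
    also have "\<dots> = cut C (X \<inter> R) (Y \<inter> S) - density C R S * row_vol C (X \<inter> R) * col_vol C (Y \<inter> S)"
      by (simp add: cut_def row_vol_def col_vol_def sum_subtractf sum_distrib_left sum_distrib_right
          mult.assoc sum_product sum.swap[of _ "X \<inter> R"])
    also have "\<bar>\<dots>\<bar> \<le> disc C P Q * sqrt (row_vol C (X \<inter> R) * col_vol C (Y \<inter> S))"
      by (rule cut_deviation_le_disc[OF that]) auto
    finally show ?thesis by (simp add: row_vol_def col_vol_def real_sqrt_mult)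
  qed
  have "(\<Sum>i\<in>X. \<Sum>j\<in>Y. deviation C P Q i j)
      = (\<Sum>R\<in>P. \<Sum>i\<in>X \<inter> R. \<Sum>S\<in>Q. \<Sum>j\<in>Y \<inter> S. deviation C P Q i j)"
    by (subst sum_partition[OF P'(1)], subst sum_partition[OF Q'(1), of _ Y]) (rule refl)
  also have "\<dots> = (\<Sum>R\<in>P. \<Sum>S\<in>Q. \<Sum>i\<in>X \<inter> R. \<Sum>j\<in>Y \<inter> S. deviation C P Q i j)"
    by (intro sum.cong refl sum.swap)
  also have "\<bar>\<dots>\<bar> \<le> (\<Sum>R\<in>P. \<Sum>S\<in>Q. disc C P Q * (?a R * ?b S))"
    by (rule order_trans[OF sum_abs sum_mono[OF order_trans[OF sum_abs sum_mono]]]) (rule block)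
  \<comment> \<open>The block bounds factor into a row part and a column part, so Cauchy-Schwarz
    applies to each side separately.\<close>
  also have "\<dots> = disc C P Q * ((\<Sum>R\<in>P. ?a R) * (\<Sum>S\<in>Q. ?b S))"
    by (simp only: sum_product) (simp only: sum_distrib_left)
  also have "\<dots> \<le> disc C P Q * ((sqrt k * sqrt (sum (row_sum C) X)) * (sqrt k * sqrt (sum (col_sum C) Y)))"
    using sum_sqrt_partition_le[OF P'(1), of "row_sum C" X] sum_sqrt_partition_le[OF Q'(1), of "col_sum C" Y]
      P' Q' row_sum_nonneg col_sum_nonneg disc_nonneg[OF P'(1) Q'(1)]
    by (intro mult_left_mono mult_mono) (auto intro!: sum_nonneg mult_nonneg_nonneg)
  also have "\<dots> = real k * disc C P Q * sqrt (sum (row_sum C) X * sum (col_sum C) Y)"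
    by (simp add: real_sqrt_mult algebra_simps)
  finally show ?thesis .
qed

text \<open>By the triangle inequality it remains to see that row \<open>i\<close> of the block
  approximation sums to at most \<open>row_sum C i\<close>. This holds because the cuts of
  \<open>R\<close> with all column parts add up to its volume.\<close>

lemma deviation_row_le:
  assumes P: "partition_on UNIV P" and Q: "partition_on UNIV Q"
  shows "(\<Sum>j\<in>UNIV. \<bar>deviation C P Q i j\<bar>) \<le> 2 * row_sum C i"
proof -
  define R where "R = part P i"
  \<comment> \<open>Equality unless \<open>col_vol C S\<close> is 0, where the left side is
    0.\<close>
  have "density C R S * col_vol C S \<le> cut C R S / row_vol C R" for S
    by (auto simp: density_def cut_nonneg row_vol_nonneg)
  then have "(\<Sum>S\<in>Q. density C R S * col_vol C S) \<le> (\<Sum>S\<in>Q. cut C R S / row_vol C R)"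
    by (intro sum_mono)
  also have "\<dots> = cut C R UNIV / row_vol C R"
    unfolding cut_def sum_divide_distrib[symmetric]
    by (subst sum.swap) (simp add: sum_partition[OF Q, of _ UNIV])
  also have "\<dots> \<le> 1"
    using cut_le_row_vol[of R UNIV] row_vol_nonneg[of R]
    by (cases "row_vol C R = 0") auto
  finally have le1: "(\<Sum>S\<in>Q. density C R S * col_vol C S) \<le> 1" .
  have "(\<Sum>j\<in>UNIV. \<bar>deviation C P Q i j\<bar>)
      \<le> (\<Sum>j\<in>UNIV. C $ i $ j + density C R (part Q j) * row_sum C i * col_sum C j)"
    unfolding deviation_def R_def
    using nonneg density_nonneg row_sum_nonneg col_sum_nonneg
    by (intro sum_mono order_trans[OF abs_triangle_ineq4]) (simp add: abs_mult)
  also have "\<dots> = row_sum C i + row_sum C i * (\<Sum>j\<in>UNIV. density C R (part Q j) * col_sum C j)"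
    by (simp add: sum.distrib row_sum_def sum_distrib_left mult_ac)
  also have "(\<Sum>j\<in>UNIV. density C R (part Q j) * col_sum C j)
      = (\<Sum>S\<in>Q. \<Sum>j\<in>S. density C R (part Q j) * col_sum C j)"
    by (subst sum_partition[OF Q]) simp
  also have "\<dots> = (\<Sum>S\<in>Q. density C R S * col_vol C S)"
    unfolding col_vol_def sum_distrib_left by (intro sum.cong refl) (simp add: part_eq[OF Q])
  also have "row_sum C i + row_sum C i * \<dots> \<le> row_sum C i + row_sum C i * 1"
    using le1 row_sum_nonneg by (intro add_left_mono mult_left_mono)
  finally show ?thesis by simp
qed

end

lemma deviation_col_le:
  assumes "\<forall>i j. 0 \<le> C $ i $ j" "partition_on UNIV P" "partition_on UNIV Q"
  shows "(\<Sum>i\<in>UNIV. \<bar>deviation C P Q i j\<bar>) \<le> 2 * col_sum C j"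
  using deviation_row_le[of "transpose C" Q P j] assms
  by (simp add: deviation_transpose row_sum_transpose) (simp add: transpose_def)

section \<open>Bilinear form of the normalized table\<close>

lemma powr_minus_half_props:
  fixes x :: real
  assumes "0 \<le> x"
  shows "x * x powr (-1/2) = sqrt x" "x * (x powr (-1/2))\<^sup>2 \<le> 1"
proof -
  \<comment> \<open>At \<open>x = 0\<close> both sides are 0 by convention, which is why the second
    claim is an inequality.\<close>
  have *: "x powr (-1/2) = 1 / sqrt x"
    using assms powr_minus_divide[of x "1/2"] by (simp add: powr_half_sqrt)
  show "x * x powr (-1/2) = sqrt x" unfolding * using assms by (simp add: real_div_sqrt)
  show "x * (x powr (-1/2))\<^sup>2 \<le> 1" unfolding * using assms by (simp add: power_divide)
qed

text \<open>Absorbing the inverse square roots into \<open>u\<close> and \<open>v\<close> turns the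
  form into one of \<open>C\<close> with test functions of weighted energy at most 1. Orthogonality
  is a disjunction so that the constraint may sit on the row side or on the column side.\<close>

lemma normalized_table_bilinear_le:
  fixes C :: "real^'n^'m"
  assumes nonneg: "\<forall>i j. 0 \<le> C $ i $ j"
    and P: "proper_partition k P" and Q: "proper_partition k Q"
    and u: "norm u \<le> 1" and v: "norm v \<le> 1"
    and orth: "(\<forall>R\<in>P. (\<Sum>i\<in>R. sqrt (row_sum C i) * u $ i) = 0)
             \<or> (\<forall>S\<in>Q. (\<Sum>j\<in>S. sqrt (col_sum C j) * v $ j) = 0)"
  shows "u \<bullet> (normalized_table C *v v) \<le> 16 * (real k * disc C P Q) * (2 * real L + 1) + 4 / 2 ^ L"
    and "u \<bullet> (normalized_table C *v v) \<le> 2"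
proof -
  have P': "partition_on UNIV P" and Q': "partition_on UNIV Q"
    using P Q by (auto simp: proper_partition_def)
  define f where "f i = row_sum C i powr (-1/2) * u $ i" for i
  define g where "g j = col_sum C j powr (-1/2) * v $ j" for j
  let ?E = "deviation C P Q"
  have d: "0 \<le> row_sum C i" and e: "0 \<le> col_sum C j" for i j
    using row_sum_nonneg[OF nonneg] col_sum_nonneg[OF nonneg] by auto
  have energy: "(\<Sum>i\<in>UNIV. c i * (c i powr (-1/2) * x $ i)\<^sup>2) \<le> 1"
    if "\<And>i. 0 \<le> c i" "norm x \<le> 1" for c and x :: "real^'a"
  proof -
    have "c i * (c i powr (-1/2) * x $ i)\<^sup>2 \<le> (x $ i)\<^sup>2" for i
      using mult_right_mono[OF powr_minus_half_props(2)[OF that(1)], of "(x $ i)\<^sup>2" i]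
      by (simp add: power_mult_distrib mult.assoc)
    then have "(\<Sum>i\<in>UNIV. c i * (c i powr (-1/2) * x $ i)\<^sup>2) \<le> (\<Sum>i\<in>UNIV. (x $ i)\<^sup>2)"
      by (rule sum_mono)
    also have "\<dots> = (norm x)\<^sup>2"
      unfolding power2_norm_eq_inner by (simp add: inner_vec_def power2_eq_square)
    also have "\<dots> \<le> 1" using that(2) by (simp add: power_le_one)
    finally show ?thesis .
  qed
  have f: "(\<Sum>i\<in>UNIV. row_sum C i * (f i)\<^sup>2) \<le> 1" unfolding f_def by (rule energy[OF d u])
  have g: "(\<Sum>j\<in>UNIV. col_sum C j * (g j)\<^sup>2) \<le> 1" unfolding g_def by (rule energy[OF e v])
  have df: "row_sum C i * f i = sqrt (row_sum C i) * u $ i" for i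
    unfolding f_def mult.assoc[symmetric] powr_minus_half_props(1)[OF d] ..
  have eg: "col_sum C j * g j = sqrt (col_sum C j) * v $ j" for j
    unfolding g_def mult.assoc[symmetric] powr_minus_half_props(1)[OF e] ..
  \<comment> \<open>On each block the approximation contributes a product of a row factor and a
    column factor; orthogonality on either side makes one of them vanish in every block.\<close>
  let ?D = "\<lambda>i j. density C (part P i) (part Q j) * (row_sum C i * f i) * (col_sum C j * g j)"
  have "(\<Sum>i\<in>UNIV. \<Sum>j\<in>UNIV. ?D i j) = (\<Sum>R\<in>P. \<Sum>i\<in>R. \<Sum>S\<in>Q. \<Sum>j\<in>S. ?D i j)"
    by (subst sum_partition[OF P'], subst sum_partition[OF Q', of _ UNIV]) simp
  also have "\<dots> = (\<Sum>R\<in>P. \<Sum>S\<in>Q. \<Sum>i\<in>R. \<Sum>j\<in>S. ?D i j)"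
    by (intro sum.cong refl sum.swap)
  also have "\<dots> = (\<Sum>R\<in>P. \<Sum>S\<in>Q. density C R S *
                    ((\<Sum>i\<in>R. row_sum C i * f i) * (\<Sum>j\<in>S. col_sum C j * g j)))"
    unfolding sum_product unfolding sum_distrib_left
    by (intro sum.cong refl) (simp add: part_eq[OF P'] part_eq[OF Q'] mult.assoc)
  also have "\<dots> = 0"
    using orth by (intro sum.neutral ballI) (auto simp: df eg)
  finally have zero: "(\<Sum>i\<in>UNIV. \<Sum>j\<in>UNIV. ?D i j) = 0" .
  have "u \<bullet> (normalized_table C *v v) = (\<Sum>i\<in>UNIV. \<Sum>j\<in>UNIV. C $ i $ j * f i * g j)"
    by (simp add: inner_vec_def matrix_vector_mult_def normalized_table_nth f_def g_def
        sum_distrib_left mult_ac)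
  also have "\<dots> = (\<Sum>i\<in>UNIV. \<Sum>j\<in>UNIV. ?E i j * f i * g j) + (\<Sum>i\<in>UNIV. \<Sum>j\<in>UNIV. ?D i j)"
    unfolding sum.distrib[symmetric] by (intro sum.cong refl) (simp add: deviation_def algebra_simps)
  finally have eq: "u \<bullet> (normalized_table C *v v) = (\<Sum>i\<in>UNIV. \<Sum>j\<in>UNIV. ?E i j * f i * g j)"
    using zero by simp
  note row = deviation_row_le[OF nonneg P' Q'] and col = deviation_col_le[OF nonneg P' Q']
  have "0 \<le> real k * disc C P Q" using disc_nonneg[OF nonneg P' Q'] by simp
  from bilinear_dyadic_bound[OF d e this deviation_cut_le[OF nonneg P Q] row col f g, of L]
  show "u \<bullet> (normalized_table C *v v) \<le> 16 * (real k * disc C P Q) * (2 * real L + 1) + 4 / 2 ^ L"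
    unfolding eq by linarith
  \<comment> \<open>AM-GM entry by entry replaces the dyadic splitting and gives half of the Schur
    bound 4.\<close>
  have "(\<Sum>i\<in>UNIV. \<Sum>j\<in>UNIV. ?E i j * f i * g j)
      \<le> (\<Sum>i\<in>UNIV. \<Sum>j\<in>UNIV. \<bar>?E i j\<bar> * ((f i)\<^sup>2 + (g j)\<^sup>2) / 2)"
  proof (intro sum_mono)
    fix i j
    have "\<bar>f i * g j\<bar> \<le> ((f i)\<^sup>2 + (g j)\<^sup>2) / 2"
      using sum_squares_bound[of "\<bar>f i\<bar>" "\<bar>g j\<bar>"] by (simp add: abs_mult)
    then have "\<bar>?E i j\<bar> * \<bar>f i * g j\<bar> \<le> \<bar>?E i j\<bar> * (((f i)\<^sup>2 + (g j)\<^sup>2) / 2)"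
      by (intro mult_left_mono) auto
    moreover have "?E i j * f i * g j \<le> \<bar>?E i j\<bar> * \<bar>f i * g j\<bar>"
      using abs_ge_self[of "?E i j * f i * g j"] by (simp add: abs_mult)
    ultimately show "?E i j * f i * g j \<le> \<bar>?E i j\<bar> * ((f i)\<^sup>2 + (g j)\<^sup>2) / 2" by simp
  qed
  also have "\<dots> = (\<Sum>i\<in>UNIV. \<Sum>j\<in>UNIV. \<bar>?E i j\<bar> * ((f i)\<^sup>2 + (g j)\<^sup>2)) / 2"
    by (simp add: sum_divide_distrib)
  also have "\<dots> \<le> 2" using weighted_schur_test[OF row col f g] by simp
  finally show "u \<bullet> (normalized_table C *v v) \<le> 2" unfolding eq .
qed

section \<open>Choice of the dyadic cut-off and conclusion\<close>

lemma multiway_numeric_bound: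
  fixes x \<alpha> :: real
  assumes \<alpha>: "0 \<le> \<alpha>" "\<alpha> < 1" and "1 \<le> k"
    and dyadic: "\<And>L::nat. x \<le> 16 * (real k * \<alpha>) * (2 * real L + 1) + 4 / 2 ^ L"
    and "x \<le> 2"
  shows "x \<le> 9 * \<alpha> * (real k + 2 - 9 * real k * ln \<alpha>)"
proof -
  \<comment> \<open>For \<open>\<alpha> = 0\<close> let \<open>L\<close> tend to infinity; the
    factor \<open>\<alpha>\<close> makes the right side 0 whatever \<open>ln 0\<close> is. From 1/8
    on, the right side is at least 27/8, which exceeds 2.\<close>
  consider "\<alpha> = 0" | "0 < \<alpha>" "\<alpha> < 1 / 8" | "1 / 8 \<le> \<alpha>" using \<alpha> by linarith
  then show ?thesis
  proof cases
    case 1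
    have "(\<lambda>L. 4 / 2 ^ L :: real) \<longlonglongrightarrow> 0"
      using LIMSEQ_divide_realpow_zero[of 2 4] by simp
    then have "x \<le> 0"
      by (rule LIMSEQ_le_const) (use dyadic 1 in auto)
    with 1 show ?thesis by simp
  next
    case 2
    define l where "l = - ln \<alpha>"
    define L where "L = nat \<lceil>log 2 (1 / \<alpha>)\<rceil>"
    \<comment> \<open>A rational lower bound: it turns \<open>l / ln 2\<close> into at most
      \<open>8 / 5 * l\<close>, and \<open>\<alpha> < 1 / 8\<close> into
      \<open>l \<ge> 15 / 8\<close>.\<close>
    have ln2: "5 / 8 \<le> ln (2::real)" using ln2_ge_two_thirds by simp
    have log: "log 2 (1 / \<alpha>) = l / ln 2" using 2 by (simp add: log_def l_def ln_div)
    have "ln \<alpha> \<le> ln (1 / 2 ^ 3)" using 2 by (subst ln_le_cancel_iff) auto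
    also have "\<dots> = - (3 * ln 2)" using ln_realpow[of 2 3] by (simp only: ln_div) simp
    finally have l: "15 / 8 \<le> l" using ln2 by (simp add: l_def)
    have "l / ln 2 \<le> l / (5 / 8)" using l ln2 by (intro divide_left_mono) auto
    moreover have "real L \<le> l / ln 2 + 1"
      using l unfolding L_def log by (simp add: of_nat_nat)
    ultimately have "2 * real L + 1 \<le> 16 / 5 * l + 3" by simp
    then have "16 * (real k * \<alpha>) * (2 * real L + 1) \<le> 16 * (real k * \<alpha>) * (16 / 5 * l + 3)"
      using \<alpha> by (intro mult_left_mono) auto
    moreover have "4 / 2 ^ L \<le> 4 * \<alpha>"
    proof -
      have "1 / \<alpha> = 2 powr log 2 (1 / \<alpha>)" using 2 by simp
      also have "\<dots> \<le> 2 powr real L" unfolding L_def by (intro powr_mono) linarith+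
      also have "\<dots> = 2 ^ L" by (simp add: powr_realpow)
      finally show ?thesis using 2 by (simp add: field_simps)
    qed
    \<comment> \<open>Of the 48 copies of \<open>k * \<alpha>\<close> from the dyadic bound, 9 are
      matched on the right. The other 39 are absorbed into the logarithmic term, where 51.2 + 29
      stays below 81.\<close>
    moreover have "39 * (real k * \<alpha>) \<le> 29 * (real k * \<alpha>) * l"
      using mult_left_mono[of "39 / 29" l "29 * (real k * \<alpha>)"] l \<alpha> by (simp add: mult_ac)
    moreover have "0 \<le> real k * \<alpha> * l" using l \<alpha> by simp
    moreover have "9 * \<alpha> * (real k + 2 - 9 * real k * ln \<alpha>)
        = 9 * (real k * \<alpha>) + 18 * \<alpha> + 81 * (real k * \<alpha> * l)"
      by (simp add: l_def algebra_simps)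
    ultimately show ?thesis using dyadic[of L] \<alpha> by (simp add: algebra_simps)
  next
    case 3
    have "ln \<alpha> \<le> 0" using 3 \<alpha> by simp
    then have "real k * ln \<alpha> \<le> 0" by (simp add: mult_nonneg_nonpos)
    then have "3 \<le> real k + 2 - 9 * real k * ln \<alpha>" using \<open>1 \<le> k\<close> by linarith
    then have "9 * (1 / 8) * 3 \<le> 9 * \<alpha> * (real k + 2 - 9 * real k * ln \<alpha>)"
      using 3 by (intro mult_mono) auto
    with \<open>x \<le> 2\<close> show ?thesis by simp
  qed
qed

lemma min_disc_attained:
  fixes C :: "real^'n^'m"
  assumes "1 \<le> k" "k \<le> CARD('m)" "k \<le> CARD('n)"
  obtains P Q where "proper_partition k P" "proper_partition k Q" "min_disc k C = disc C P Q"
proof -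
  let ?D = "{disc C P Q | P Q. proper_partition k P \<and> proper_partition k Q}"
  have "finite (range (\<lambda>(P, Q). disc C P Q))" by simp
  then have "finite ?D" by (rule finite_subset[rotated]) auto
  moreover have "?D \<noteq> {}"
    using partition_on_UNIV_card_exists[OF assms(1,2)] partition_on_UNIV_card_exists[OF assms(1,3)] by blast
  ultimately have "min_disc k C \<in> ?D" unfolding min_disc_def by (rule Min_in)
  then show ?thesis using that by blast
qed

theorem theorem1:
  fixes C :: "real^'n^'m" and k :: nat
  assumes "\<forall>i j. 0 \<le> C $ i $ j"
    and "non_decomposable C"
    and "1 \<le> k" and "k \<le> rank C"
    and "min_disc k C < 1"
  shows "singular_value (normalized_table C) k
           \<le> 9 * min_disc k C * (real k + 2 - 9 * real k * ln (min_disc k C))"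
proof -
  let ?N = "normalized_table C"
  \<comment> \<open>The rank is at most both dimensions, so \<open>k\<close>-partitions of both
    index sets exist.\<close>
  have k: "k \<le> CARD('m)" "k \<le> CARD('n)" using assms(4) rank_bound[of C] by auto
  obtain P Q where P: "proper_partition k P" and Q: "proper_partition k Q"
    and md: "min_disc k C = disc C P Q"
    using min_disc_attained[OF assms(3) k] .
  have \<alpha>: "0 \<le> disc C P Q"
    using disc_nonneg[OF assms(1)] P Q by (simp add: proper_partition_def)
  let ?\<beta> = "9 * disc C P Q * (real k + 2 - 9 * real k * ln (disc C P Q))"
  have bil: "u \<bullet> (?N *v v) \<le> ?\<beta>"
    if "norm u \<le> 1" "norm v \<le> 1"
      "(\<forall>R\<in>P. part_vector (row_sum C) R \<bullet> u = 0) \<or> (\<forall>S\<in>Q. part_vector (col_sum C) S \<bullet> v = 0)" for u v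
    using normalized_table_bilinear_le[OF assms(1) P Q that[unfolded part_vector_inner]] assms(3,5) \<alpha> md
    by (intro multiway_numeric_bound) auto
  have card: "card (h ` P) \<le> k" "card (h' ` Q) \<le> k" for h :: "'m set \<Rightarrow> real^'m" and h' :: "'n set \<Rightarrow> real^'n"
    using P Q card_image_le[of P h] card_image_le[of Q h'] by (auto simp: proper_partition_def)
  have "singular_value ?N k \<le> ?\<beta>"
  proof (cases "k < length (singular_values ?N)")
    case False
    \<comment> \<open>Past the end of the list the singular value is 0; zero test vectors show that
      the bound is nonnegative.\<close>
    then show ?thesis using bil[of 0 0] by (simp add: singular_value_def)
  next
    case True
    show ?thesis
    proof (cases "CARD('m) \<le> CARD('n)")
      case le: True
      have "sqrt (eigenvalue_list (?N ** transpose ?N) ! k) \<le> ?\<beta>"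
        using True le card
        by (intro sqrt_eigenvalue_list_nth_le[where V = "part_vector (row_sum C) ` P"] bil)
          (auto simp: singular_values_def)
      then show ?thesis using True le by (simp add: singular_value_def singular_values_def)
    next
      case gt: False
      \<comment> \<open>The double transpose puts the Gram matrix on the column side into the form
        of the general lemma, now with the column part vectors as constraints.\<close>
      have "sqrt (eigenvalue_list (transpose ?N ** transpose (transpose ?N)) ! k) \<le> ?\<beta>"
      proof (rule sqrt_eigenvalue_list_nth_le[where V = "part_vector (col_sum C) ` Q"])
        fix u :: "real^'n" and v :: "real^'m"
        assume uv: "norm u \<le> 1" "norm v \<le> 1" "\<And>q. q \<in> part_vector (col_sum C) ` Q \<Longrightarrow> q \<bullet> u = 0"
        have "u \<bullet> (transpose ?N *v v) = v \<bullet> (?N *v u)"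
          using inner_matrix_vector_transpose[of u "transpose ?N" v] by (simp add: inner_commute)
        also have "\<dots> \<le> ?\<beta>" using uv by (intro bil) auto
        finally show "u \<bullet> (transpose ?N *v v) \<le> ?\<beta>" .
      qed (use True gt card in \<open>auto simp: singular_values_def\<close>)
      then show ?thesis using True gt by (simp add: singular_value_def singular_values_def)
    qed
  qed
  then show ?thesis by (simp add: md)
qed

end
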